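(* For every integer $n\ge1$, \[ CP_{(2,0)}(n,X,Y)=\prod_{i=1}^{n}\frac{1-X_{i-1}X_{i}Y_{i-2}Y_{i-1}}{(1-X_{i}Y_{i-2})(1-X_{i}Y_{i-1})(1-X_{i}Y_{i})}. \]
   Context: Let $x_1,x_2,\dots,y_1,y_2,\dots$ be formal variables, $X_i:=x_1\cdots x_i$, $Y_i:=y_1\cdots y_i$ for $i\ge1$, and $X_i=Y_i:=1$ for $i\le 0$. For $n\ge1$, $CP_{(2,0)}(n,X,Y):=\sum \prod_{i=1}^n x_i^{a_i}y_i^{b_i}$, summed over all tuples of nonnegative integers $(a_1,\dots,a_n,b_1,\dots,b_n)$ with $a_1\ge\dots\ge a_n$, $b_1\ge\dots\ge b_n$, $a_j\ge b_{j}$ and $b_j\ge a_{j+2}$ for all $j\ge1$, where $a_j=b_j=0$ for $j>n$ (cylindric partitions with profile $(2,0)$ with at most $n$ nonzero entries in each row). *)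

theory Defs
  imports "HOL-Library.Multiset"
begin

section \<open>Formal power series in arbitrarily many commuting variables\<close>

text \<open>
  A monomial is represented by the finite multiset of its variables, so that the product of
  monomials is the sum of multisets and \<open>{#}\<close> is the monomial \<open>1\<close>.
  A power series is an arbitrary assignment of coefficients to monomials.
\<close>

typedef ('v, 'a) mps = "UNIV :: ('v multiset \<Rightarrow> 'a) set"
  morphisms mps_nth Abs_mps
  by simp

setup_lifting type_definition_mps

lemma mps_eqI: "(\<And>m. mps_nth f m = mps_nth g m) \<Longrightarrow> f = g"
  by transfer blast

lemma finite_mset_splits: "finite {(A, B). A + B = (m :: 'v multiset)}"
proof -
  have fin: "finite {A. A \<subseteq># m}"
  proof (induction m)
    case empty
    then show ?case by simp
  next
    case (add x m)
    have "{A. A \<subseteq># add_mset x m} \<subseteq> {A. A \<subseteq># m} \<union> add_mset x ` {A. A \<subseteq># m}"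
    proof
      fix A assume "A \<in> {A. A \<subseteq># add_mset x m}"
      then have A: "A \<subseteq># add_mset x m" by simp
      show "A \<in> {A. A \<subseteq># m} \<union> add_mset x ` {A. A \<subseteq># m}"
      proof (cases "x \<in># A")
        case True
        then obtain B where "A = add_mset x B" by (meson mset_add)
        with A show ?thesis by auto
      next
        case False
        have "count A z \<le> count m z" for z
          using A False mset_subset_eq_count [OF A, of z] by (cases "z = x") (simp_all add: not_in_iff)
        then show ?thesis by (simp add: subseteq_mset_def)
      qed
    qed
    then show ?case using add.IH by (meson finite_UnI finite_imageI finite_subset)
  qed
  have "{(A, B). A + B = m} \<subseteq> (\<lambda>A. (A, m - A)) ` {A. A \<subseteq># m}"
    by auto
  then show ?thesis using fin by (meson finite_imageI finite_subset)
qed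

instantiation mps :: (type, comm_ring_1) comm_ring_1
begin

lift_definition zero_mps :: "('a, 'b) mps" is "\<lambda>_. 0" .
lift_definition one_mps :: "('a, 'b) mps" is "\<lambda>m. if m = {#} then 1 else 0" .
lift_definition plus_mps :: "('a, 'b) mps \<Rightarrow> ('a, 'b) mps \<Rightarrow> ('a, 'b) mps"
  is "\<lambda>f g m. f m + g m" .
lift_definition minus_mps :: "('a, 'b) mps \<Rightarrow> ('a, 'b) mps \<Rightarrow> ('a, 'b) mps"
  is "\<lambda>f g m. f m - g m" .
lift_definition uminus_mps :: "('a, 'b) mps \<Rightarrow> ('a, 'b) mps"
  is "\<lambda>f m. - f m" .
lift_definition times_mps :: "('a, 'b) mps \<Rightarrow> ('a, 'b) mps \<Rightarrow> ('a, 'b) mps"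
  is "\<lambda>f g m. \<Sum>(A, B) \<in> {(A, B). A + B = m}. f A * g B" .

instance
proof
  fix f g h :: "('a, 'b) mps"
  show "f * g * h = f * (g * h)"
  proof transfer
    fix f g h :: "'a multiset \<Rightarrow> 'b"
    show "(\<lambda>m. \<Sum>(A, B) \<in> {(A, B). A + B = m}. (\<Sum>(C, D) \<in> {(C, D). C + D = A}. f C * g D) * h B)
        = (\<lambda>m. \<Sum>(A, B) \<in> {(A, B). A + B = m}. f A * (\<Sum>(C, D) \<in> {(C, D). C + D = B}. g C * h D))"
    proof
      fix m :: "'a multiset"
      have "(\<Sum>(A, B) \<in> {(A, B). A + B = m}. (\<Sum>(C, D) \<in> {(C, D). C + D = A}. f C * g D) * h B)
          = (\<Sum>p \<in> {(A, B). A + B = m}. \<Sum>q \<in> {(C, D). C + D = fst p}.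
               f (fst q) * g (snd q) * h (snd p))"
        by (simp add: sum_distrib_right case_prod_beta)
      also have "\<dots> = (\<Sum>(p, q) \<in> (SIGMA p:{(A, B). A + B = m}. {(C, D). C + D = fst p}).
               f (fst q) * g (snd q) * h (snd p))"
        by (rule sum.Sigma) (auto simp: finite_mset_splits)
      also have "\<dots> = (\<Sum>(p, q) \<in> (SIGMA p:{(A, B). A + B = m}. {(C, D). C + D = snd p}).
               f (fst p) * (g (fst q) * h (snd q)))"
        by (rule sum.reindex_bij_witness
              [where i = "\<lambda>((A, B), (C, D)). ((A + C, D), (A, C))"
                 and j = "\<lambda>((A, B), (C, D)). ((C, D + B), (D, B))"])
           (auto simp: add.assoc mult.assoc)
      also have "\<dots> = (\<Sum>p \<in> {(A, B). A + B = m}. \<Sum>q \<in> {(C, D). C + D = snd p}.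
               f (fst p) * (g (fst q) * h (snd q)))"
        by (rule sum.Sigma [symmetric]) (auto simp: finite_mset_splits)
      also have "\<dots> = (\<Sum>(A, B) \<in> {(A, B). A + B = m}. f A * (\<Sum>(C, D) \<in> {(C, D). C + D = B}. g C * h D))"
        by (simp add: sum_distrib_left case_prod_beta)
      finally show "(\<Sum>(A, B) \<in> {(A, B). A + B = m}. (\<Sum>(C, D) \<in> {(C, D). C + D = A}. f C * g D) * h B)
          = (\<Sum>(A, B) \<in> {(A, B). A + B = m}. f A * (\<Sum>(C, D) \<in> {(C, D). C + D = B}. g C * h D))" .
    qed
  qed
  show "f * g = g * f"
  proof transfer
    fix f g :: "'a multiset \<Rightarrow> 'b"
    show "(\<lambda>m. \<Sum>(A, B) \<in> {(A, B). A + B = m}. f A * g B)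
        = (\<lambda>m. \<Sum>(A, B) \<in> {(A, B). A + B = m}. g A * f B)"
      by (intro ext, rule sum.reindex_bij_witness [where i = prod.swap and j = prod.swap])
         (auto simp: add.commute mult.commute)
  qed
  show "1 * f = f"
  proof transfer
    fix f :: "'a multiset \<Rightarrow> 'b"
    show "(\<lambda>m. \<Sum>(A, B) \<in> {(A, B). A + B = m}. (if A = {#} then 1 else 0) * f B) = f"
    proof
      fix m :: "'a multiset"
      have "(\<Sum>(A, B) \<in> {(A, B). A + B = m}. (if A = {#} then 1 else 0) * f B)
          = (\<Sum>(A, B) \<in> {({#} :: 'a multiset, m)}. (if A = {#} then 1 else 0) * f B)"
        by (rule sum.mono_neutral_right) (auto simp: finite_mset_splits split: if_splits)
      then show "(\<Sum>(A, B) \<in> {(A, B). A + B = m}. (if A = {#} then 1 else 0) * f B) = f m"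
        by simp
    qed
  qed
  show "(f + g) * h = f * h + g * h"
    by transfer (auto simp: fun_eq_iff distrib_right sum.distrib case_prod_beta)
  show "(0 :: ('a, 'b) mps) \<noteq> 1"
    by transfer (auto simp: fun_eq_iff)
qed (transfer; simp add: fun_eq_iff algebra_simps)+

end

text \<open>
  The quotient \<open>f / g\<close> is the product of \<open>f\<close> with the inverse of \<open>g\<close> in the ring of power
  series; the junk value \<open>0\<close> is used if \<open>g\<close> is not a unit.
\<close>

instantiation mps :: (type, comm_ring_1) inverse
begin

definition inverse_mps :: "('a, 'b) mps \<Rightarrow> ('a, 'b) mps"
  where "inverse_mps f = (if \<exists>g. f * g = 1 then THE g. f * g = 1 else 0)"

definition divide_mps :: "('a, 'b) mps \<Rightarrow> ('a, 'b) mps \<Rightarrow> ('a, 'b) mps"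
  where "divide_mps f g = f * inverse g"

instance ..

end

lemma mps_inverse_unique:
  fixes f g :: "('v, 'a :: comm_ring_1) mps"
  assumes "f * g = 1"
  shows "inverse f = g"
proof -
  have "h = g" if "f * h = 1" for h
  proof -
    have "h = (f * g) * h" using assms by simp
    also have "\<dots> = (f * h) * g" by (simp only: ac_simps)
    also have "\<dots> = g" using that by simp
    finally show ?thesis .
  qed
  with assms have "(THE g. f * g = 1) = g" by (rule the_equality)
  with assms show ?thesis unfolding inverse_mps_def by auto
qed

lift_definition mps_monom :: "'v multiset \<Rightarrow> ('v, 'a :: comm_ring_1) mps"
  is "\<lambda>m m'. if m' = m then 1 else 0" .

abbreviation mps_var :: "'v \<Rightarrow> ('v, 'a :: comm_ring_1) mps"
  where "mps_var v \<equiv> mps_monom {#v#}"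

lemma mps_monom_mult: "mps_monom A * mps_monom B = (mps_monom (A + B) :: ('v, 'a :: comm_ring_1) mps)"
proof (rule mps_eqI)
  fix m :: "'v multiset"
  have "mps_nth (mps_monom A * mps_monom B :: ('v, 'a) mps) m
      = (\<Sum>p \<in> {(C, D). C + D = m}. if p = (A, B) then 1 else 0)"
    unfolding times_mps.rep_eq mps_monom.rep_eq by (rule sum.cong) (auto split: if_splits)
  also have "\<dots> = mps_nth (mps_monom (A + B)) m"
    by (auto simp: finite_mset_splits mps_monom.rep_eq)
  finally show "mps_nth (mps_monom A * mps_monom B :: ('v, 'a) mps) m = mps_nth (mps_monom (A + B)) m" .
qed

lemma mps_monom_empty: "mps_monom {#} = 1"
  by transfer simp

lemma mps_monom_power: "mps_monom A ^ k = mps_monom (repeat_mset k A)"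
  by (induction k) (simp_all add: mps_monom_mult mps_monom_empty)

lemma mps_monom_prod: "(\<Prod>i\<in>I. mps_monom (A i)) = mps_monom (\<Sum>i\<in>I. A i)"
  by (induction I rule: infinite_finite_induct) (simp_all add: mps_monom_mult mps_monom_empty)

lemma mps_inverse_one_minus_monom:
  assumes "A \<noteq> {#}"
  shows "(1 - mps_monom A) * inverse (1 - mps_monom A) = (1 :: ('v, 'a :: comm_ring_1) mps)"
proof -
  define g :: "('v, 'a) mps"
    where "g = Abs_mps (\<lambda>m. if \<exists>k. m = repeat_mset k A then 1 else 0)"
  have g: "mps_nth g m = (if \<exists>k. m = repeat_mset k A then 1 else 0)" for m
    by (simp add: g_def Abs_mps_inverse)
  have Ag: "mps_nth (mps_monom A * g) m = (if \<exists>k. m = repeat_mset (Suc k) A then 1 else 0)" for m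
  proof -
    have "mps_nth (mps_monom A * g) m
        = (\<Sum>(C, D) \<in> {(C, D). C + D = m}. (if C = A then 1 else 0) * mps_nth g D)"
      unfolding times_mps.rep_eq mps_monom.rep_eq ..
    also have "\<dots> = (\<Sum>(C, D) \<in> {(C, D). C = A \<and> A + D = m}. mps_nth g D)"
      by (rule sum.mono_neutral_cong_right) (auto simp: finite_mset_splits split: if_splits)
    also have "\<dots> = (if \<exists>k. m = repeat_mset (Suc k) A then 1 else 0)"
    proof (cases "A \<subseteq># m")
      case True
      then obtain D where D: "m = A + D" by (metis subset_mset.le_iff_add)
      then have "{(C, D). C = A \<and> A + D = m} = {(A, D)}" by auto
      then show ?thesis by (simp add: g D)
    next
      case False
      then have "{(C, D). C = A \<and> A + D = m} = {}" by auto
      moreover from False have "\<not> (\<exists>k. m = repeat_mset (Suc k) A)" by auto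
      ultimately show ?thesis by (simp only: sum.empty if_False)
    qed
    finally show ?thesis .
  qed
  have "(1 - mps_monom A) * g = 1"
  proof (rule mps_eqI)
    fix m :: "'v multiset"
    define P Q where "P \<longleftrightarrow> (\<exists>k. m = repeat_mset k A)" and "Q \<longleftrightarrow> (\<exists>k. m = repeat_mset (Suc k) A)"
    have "P \<longleftrightarrow> m = {#} \<or> Q"
    proof
      assume P
      then obtain k where "m = repeat_mset k A" unfolding P_def by blast
      then show "m = {#} \<or> Q" unfolding Q_def by (cases k) auto
    next
      assume "m = {#} \<or> Q"
      moreover have "{#} = repeat_mset 0 A" by simp
      ultimately show P unfolding P_def Q_def by blast
    qed
    moreover have "\<not> (m = {#} \<and> Q)"
      using assms unfolding Q_def by auto
    moreover have "mps_nth g m = (if P then 1 else 0)"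
      and "mps_nth (mps_monom A * g) m = (if Q then 1 else 0)"
      unfolding P_def Q_def by (rule g, rule Ag)
    ultimately show "mps_nth ((1 - mps_monom A) * g) m = mps_nth 1 m"
      by (simp add: left_diff_distrib minus_mps.rep_eq one_mps.rep_eq)
  qed
  then show ?thesis
    using mps_inverse_unique by metis
qed

text \<open>
  The formal sum of a family of power series, taken coefficientwise. It is meaningful only if
  every monomial occurs in finitely many members of the family.
\<close>

definition mps_summable :: "('i \<Rightarrow> ('v, 'a :: comm_ring_1) mps) \<Rightarrow> 'i set \<Rightarrow> bool"
  where "mps_summable F I \<longleftrightarrow> (\<forall>m. finite {i \<in> I. mps_nth (F i) m \<noteq> 0})"

lift_definition mps_sum :: "('i \<Rightarrow> ('v, 'a :: comm_ring_1) mps) \<Rightarrow> 'i set \<Rightarrow> ('v, 'a) mps"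
  is "\<lambda>F I m. \<Sum>i \<in> {i \<in> I. F i m \<noteq> 0}. F i m" .


section \<open>Cylindric partitions with profile \<open>(2,0)\<close>\<close>

datatype var = Vx nat | Vy nat

abbreviation xvar :: "nat \<Rightarrow> (var, int) mps" where "xvar i \<equiv> mps_var (Vx i)"
abbreviation yvar :: "nat \<Rightarrow> (var, int) mps" where "yvar i \<equiv> mps_var (Vy i)"

text \<open>Both products are empty, i.e. equal to \<open>1\<close>, for \<open>i \<le> 0\<close>.\<close>

definition Xprod :: "int \<Rightarrow> (var, int) mps" where "Xprod i = (\<Prod>j=1..nat i. xvar j)"
definition Yprod :: "int \<Rightarrow> (var, int) mps" where "Yprod i = (\<Prod>j=1..nat i. yvar j)"

text \<open>
  The rows are indexed from \<open>1\<close> and extended by zero beyond \<open>n\<close>; the unused value at index \<open>0\<close>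
  is also \<open>0\<close>, so that each tuple is represented exactly once.
\<close>

definition cylindric_partitions_20 :: "nat \<Rightarrow> ((nat \<Rightarrow> nat) \<times> (nat \<Rightarrow> nat)) set"
  where "cylindric_partitions_20 n = {(a, b).
    (\<forall>j. j \<notin> {1..n} \<longrightarrow> a j = 0 \<and> b j = 0) \<and>
    (\<forall>j\<ge>1. a j \<ge> a (j + 1) \<and> b j \<ge> b (j + 1)) \<and>
    (\<forall>j\<ge>1. a j \<ge> b j \<and> b j \<ge> a (j + 2))}"

definition CP_20 :: "nat \<Rightarrow> (var, int) mps"
  where "CP_20 n = mps_sum (\<lambda>(a, b). \<Prod>i=1..n. xvar i ^ a i * yvar i ^ b i) (cylindric_partitions_20 n)"

lemma CP_20_summable:
  "mps_summable (\<lambda>(a, b). \<Prod>i=1..n. xvar i ^ a i * yvar i ^ b i) (cylindric_partitions_20 n)"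
  unfolding mps_summable_def
proof
  fix m :: "var multiset"
  let ?M = "\<lambda>a b. \<Sum>i=1..n. repeat_mset (a i) {#Vx i#} + repeat_mset (b i) {#Vy i#}"
  let ?S = "{p \<in> cylindric_partitions_20 n.
    mps_nth (case p of (a, b) \<Rightarrow> \<Prod>i=1..n. xvar i ^ a i * yvar i ^ b i) m \<noteq> 0}"
  have monom: "(\<Prod>i=1..n. xvar i ^ a i * yvar i ^ b i) = mps_monom (?M a b)" for a b
    by (simp only: mps_monom_power mps_monom_mult mps_monom_prod)
  have cx: "count (?M a b) (Vx j) = a j" if "j \<in> {1..n}" for a b j
  proof -
    have "count (?M a b) (Vx j) = (\<Sum>i=1..n. if i = j then a i else 0)"
      unfolding count_sum by (rule sum.cong) auto
    then show ?thesis using that by simp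
  qed
  have cy: "count (?M a b) (Vy j) = b j" if "j \<in> {1..n}" for a b j
  proof -
    have "count (?M a b) (Vy j) = (\<Sum>i=1..n. if i = j then b i else 0)"
      unfolding count_sum by (rule sum.cong) auto
    then show ?thesis using that by simp
  qed
  have "p = (\<lambda>j. if j \<in> {1..n} then count m (Vx j) else 0,
             \<lambda>j. if j \<in> {1..n} then count m (Vy j) else 0)" if "p \<in> ?S" for p
  proof -
    obtain a b where p: "p = (a, b)" by force
    from that have "mps_nth (mps_monom (?M a b) :: (var, int) mps) m \<noteq> 0"
      unfolding p mem_Collect_eq prod.case monom by blast
    then have m: "m = ?M a b"
      by (simp only: mps_monom.rep_eq split: if_splits)
    from that have z: "a j = 0 \<and> b j = 0" if "j \<notin> {1..n}" for j
      using that unfolding p cylindric_partitions_20_def by blast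
    show ?thesis
      unfolding p m using z cx cy by (auto simp: fun_eq_iff)
  qed
  then have "?S \<subseteq> {(\<lambda>j. if j \<in> {1..n} then count m (Vx j) else 0,
             \<lambda>j. if j \<in> {1..n} then count m (Vy j) else 0)}"
    by blast
  then show "finite ?S"
    using finite_subset by blast
qed

end

theory Submission
  imports Defs
begin

text \<open>
  Write \<open>C(p,q)\<close> for the cylindric partitions with \<open>a\<close> supported on \<open>{1..p}\<close> and \<open>b\<close> on
  \<open>{1..q}\<close>. If \<open>q \<le> p \<le> q + 2\<close>, adding \<open>1\<close> to all of these entries maps \<open>C(p,q)\<close> injectively
  into itself, and the elements missed are those in which \<open>a\<^sub>p\<close> or \<open>b\<^sub>q\<close> vanishes. Hence
  \<open>(1 - X\<^sub>p Y\<^sub>q) C(p,q)\<close> is the series of \<open>C(p-1,q) \<union> C(p,q-1)\<close>. One of the two sets contains the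
  other except for \<open>p = q + 1\<close>, where their intersection is \<open>C(p-1,q-1)\<close>. Combining the cases
  \<open>(n,n)\<close>, \<open>(n,n-1)\<close>, \<open>(n,n-2)\<close> and \<open>(n-1,n-1)\<close> gives the recurrence from \<open>n-1\<close> to \<open>n\<close>.
\<close>

section \<open>Series of sets of monomials\<close>

text \<open>Indicator coefficients make sense for infinite sets too, so identities between sets of
  monomials become identities of series without any summability argument.\<close>

lift_definition mps_of_set :: "'v multiset set \<Rightarrow> ('v, 'a :: comm_ring_1) mps"
  is "\<lambda>S m. if m \<in> S then 1 else 0" .

lemma mps_of_set_empty_mset: "mps_of_set {{#}} = 1"
  by transfer auto

lemma mps_of_set_Un:
  "mps_of_set (S \<union> T) = mps_of_set S + mps_of_set T - mps_of_set (S \<inter> T)"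
  by transfer auto

lemma mps_nth_monom_mult_add:
  "mps_nth (mps_monom A * f) (A + m) = mps_nth f m"
proof -
  have "mps_nth (mps_monom A * f) (A + m)
      = (\<Sum>(C, D) \<in> {(C, D). C + D = A + m}. (if C = A then 1 else 0) * mps_nth f D)"
    unfolding times_mps.rep_eq mps_monom.rep_eq ..
  also have "\<dots> = (\<Sum>(C, D) \<in> {(A, m)}. mps_nth f D)"
    by (rule sum.mono_neutral_cong_right) (auto simp: finite_mset_splits split: if_splits)
  finally show ?thesis by simp
qed

lemma mps_nth_monom_mult_eq_0:
  assumes "\<not> A \<subseteq># m"
  shows "mps_nth (mps_monom A * f) m = 0"
  unfolding times_mps.rep_eq mps_monom.rep_eq
  using assms by (intro sum.neutral) auto

text \<open>Translation by \<open>A\<close> is injective by cancellation, and the last two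
  hypotheses make \<open>T - S\<close> its image on \<open>T\<close>. The factor therefore removes
  exactly the monomials outside \<open>S\<close>.\<close>

lemma one_minus_monom_mult_mps_of_set:
  assumes "S \<subseteq> T"
    and "\<And>t. t \<in> T \<Longrightarrow> A + t \<in> T - S"
    and "\<And>m. m \<in> T - S \<Longrightarrow> A \<subseteq># m \<and> m - A \<in> T"
  shows "(1 - mps_monom A) * mps_of_set T = (mps_of_set S :: ('v, 'a :: comm_ring_1) mps)"
proof (rule mps_eqI)
  fix m
  have "mps_nth (mps_monom A * mps_of_set T :: ('v, 'a) mps) m = (if m \<in> T - S then 1 else 0)"
  proof (cases "A \<subseteq># m")
    case True
    then obtain t where t: "m = A + t"
      using subset_mset.le_iff_add by blast
    have "A + t \<in> T - S \<longleftrightarrow> t \<in> T"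
    proof
      assume "A + t \<in> T - S"
      then show "t \<in> T" using assms(3)[of "A + t"] by simp
    qed (rule assms(2))
    then show ?thesis
      unfolding t mps_nth_monom_mult_add mps_of_set.rep_eq by (simp only:)
  next
    case False
    then have "m \<notin> T - S" using assms(3) by blast
    then show ?thesis
      using mps_nth_monom_mult_eq_0[OF False] by (simp only: if_False)
  qed
  then show "mps_nth ((1 - mps_monom A) * mps_of_set T) m = mps_nth (mps_of_set S :: ('v, 'a) mps) m"
    using subsetD[OF assms(1), of m]
    by (simp add: left_diff_distrib minus_mps.rep_eq mps_of_set.rep_eq)
qed

text \<open>By injectivity each fibre of \<open>f\<close> has at most one element, so every
  coefficient is 0 or 1.\<close>

lemma mps_sum_monom:
  assumes "inj_on f I"
  shows "mps_sum (\<lambda>i. mps_monom (f i)) I = mps_of_set (f ` I)"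
proof (rule mps_eqI)
  fix m
  have "mps_nth (mps_sum (\<lambda>i. mps_monom (f i) :: ('b, 'c) mps) I) m = (\<Sum>i \<in> {i \<in> I. f i = m}. 1)"
    unfolding mps_sum.rep_eq mps_monom.rep_eq by (rule sum.cong) (auto split: if_splits)
  also have "\<dots> = mps_nth (mps_of_set (f ` I)) m"
  proof (cases "m \<in> f ` I")
    case True
    then obtain i where "i \<in> I" "m = f i" by blast
    then have "{i \<in> I. f i = m} = {i}" using assms by (auto dest: inj_onD)
    then show ?thesis using True by (simp add: mps_of_set.rep_eq)
  next
    case False
    then have "{i \<in> I. f i = m} = {}" by auto
    then show ?thesis using False by (simp only: mps_of_set.rep_eq sum.empty if_False)
  qed
  finally show "mps_nth (mps_sum (\<lambda>i. mps_monom (f i) :: ('b, 'c) mps) I) m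
    = mps_nth (mps_of_set (f ` I)) m" .
qed

text \<open>The first hypothesis says that \<open>f\<close> is a unit, which rules out the junk
  value of the inverse.\<close>

lemma mps_divide_mult_cancel:
  fixes f g h k :: "('v, 'a :: comm_ring_1) mps"
  assumes "f * inverse f = 1" and "f * h = g * k"
  shows "h = g / f * k"
proof -
  have "h = (f * inverse f) * h" using assms by simp
  also have "\<dots> = inverse f * (f * h)" by (simp only: ac_simps)
  also have "\<dots> = g / f * k" unfolding assms divide_mps_def by (simp only: ac_simps)
  finally show ?thesis .
qed

lemma mps_mult_inverse_mult:
  fixes f g :: "('v, 'a :: comm_ring_1) mps"
  assumes "f * inverse f = 1" "g * inverse g = 1"
  shows "(f * g) * inverse (f * g) = 1"
proof -
  have "(f * g) * (inverse f * inverse g) = (f * inverse f) * (g * inverse g)"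
    by (simp only: ac_simps)
  then have "(f * g) * (inverse f * inverse g) = 1" using assms by simp
  then show ?thesis using mps_inverse_unique by metis
qed

section \<open>Cylindric partitions as monomials\<close>

text \<open>The exponent of \<open>X\<^sub>p Y\<^sub>q\<close>, and at the same time the filling
  with 1 in every position allowed in \<open>C(p,q)\<close>.\<close>

definition XY_mset :: "nat \<Rightarrow> nat \<Rightarrow> var multiset"
  where "XY_mset p q = (\<Sum>j=1..p. {#Vx j#}) + (\<Sum>j=1..q. {#Vy j#})"

lemma count_XY_mset [simp]:
  "count (XY_mset p q) (Vx j) = (if j \<in> {1..p} then 1 else 0)"
  "count (XY_mset p q) (Vy j) = (if j \<in> {1..q} then 1 else 0)"
proof -
  have "count (XY_mset p q) (Vx j) = (\<Sum>i=1..p. if i = j then 1 else 0)"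
    unfolding XY_mset_def count_union count_sum by (simp only: count_single) auto
  then show "count (XY_mset p q) (Vx j) = (if j \<in> {1..p} then 1 else 0)" by simp
  have "count (XY_mset p q) (Vy j) = (\<Sum>i=1..q. if i = j then 1 else 0)"
    unfolding XY_mset_def count_union count_sum by (simp only: count_single) auto
  then show "count (XY_mset p q) (Vy j) = (if j \<in> {1..q} then 1 else 0)" by simp
qed

lemma XY_mset_neq_empty: "p \<ge> 1 \<Longrightarrow> XY_mset p q \<noteq> {#}"
proof
  assume "p \<ge> 1" "XY_mset p q = {#}"
  then have "count (XY_mset p q) (Vx 1) = 0" by simp
  with \<open>p \<ge> 1\<close> show False by simp
qed

lemma Xprod_mult_Yprod: "Xprod i * Yprod j = mps_monom (XY_mset (nat i) (nat j))"
  by (simp add: Xprod_def Yprod_def XY_mset_def mps_monom_prod mps_monom_mult)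

text \<open>This is \<open>C(p,q)\<close>, each partition being stored as its monomial:
  \<open>a\<^sub>j\<close> is the multiplicity of \<open>Vx j\<close> and \<open>b\<^sub>j\<close>
  that of \<open>Vy j\<close>. Two separate bounds are kept because the recurrence leaves the
  diagonal \<open>p = q\<close>.\<close>

definition cyl_msets :: "nat \<Rightarrow> nat \<Rightarrow> var multiset set"
  where "cyl_msets p q = {m.
    (\<forall>j. j \<notin> {1..p} \<longrightarrow> count m (Vx j) = 0) \<and>
    (\<forall>j. j \<notin> {1..q} \<longrightarrow> count m (Vy j) = 0) \<and>
    (\<forall>j\<ge>1. count m (Vx (j + 1)) \<le> count m (Vx j) \<and> count m (Vy (j + 1)) \<le> count m (Vy j)) \<and>
    (\<forall>j\<ge>1. count m (Vy j) \<le> count m (Vx j) \<and> count m (Vx (j + 2)) \<le> count m (Vy j))}"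

lemma cyl_msetsI:
  assumes "\<And>j. j \<notin> {1..p} \<Longrightarrow> count m (Vx j) = 0"
    and "\<And>j. j \<notin> {1..q} \<Longrightarrow> count m (Vy j) = 0"
    and "\<And>j. j \<ge> 1 \<Longrightarrow> count m (Vx (j + 1)) \<le> count m (Vx j)"
    and "\<And>j. j \<ge> 1 \<Longrightarrow> count m (Vy (j + 1)) \<le> count m (Vy j)"
    and "\<And>j. j \<ge> 1 \<Longrightarrow> count m (Vy j) \<le> count m (Vx j)"
    and "\<And>j. j \<ge> 1 \<Longrightarrow> count m (Vx (j + 2)) \<le> count m (Vy j)"
  shows "m \<in> cyl_msets p q"
  using assms unfolding cyl_msets_def by blast

lemma cyl_msetsD:
  assumes "m \<in> cyl_msets p q"
  shows "j \<notin> {1..p} \<Longrightarrow> count m (Vx j) = 0"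
    and "j \<notin> {1..q} \<Longrightarrow> count m (Vy j) = 0"
    and "j \<ge> 1 \<Longrightarrow> count m (Vx (j + 1)) \<le> count m (Vx j)"
    and "j \<ge> 1 \<Longrightarrow> count m (Vy (j + 1)) \<le> count m (Vy j)"
    and "j \<ge> 1 \<Longrightarrow> count m (Vy j) \<le> count m (Vx j)"
    and "j \<ge> 1 \<Longrightarrow> count m (Vx (j + 2)) \<le> count m (Vy j)"
  using assms unfolding cyl_msets_def by blast+

text \<open>The exponents of a monomial recover all entries of the partition, so distinct partitions
  have distinct monomials.\<close>

lemma CP_20_eq_mps_of_set: "CP_20 n = mps_of_set (cyl_msets n n)"
proof -
  define M where "M = (\<lambda>(a :: nat \<Rightarrow> nat, b :: nat \<Rightarrow> nat).
    \<Sum>i=1..n. repeat_mset (a i) {#Vx i#} + repeat_mset (b i) {#Vy i#})"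
  have cx: "count (M (a, b)) (Vx j) = (if j \<in> {1..n} then a j else 0)" for a b j
  proof -
    have "count (M (a, b)) (Vx j) = (\<Sum>i=1..n. if i = j then a i else 0)"
      unfolding M_def prod.case count_sum by (rule sum.cong) auto
    then show ?thesis by simp
  qed
  have cy: "count (M (a, b)) (Vy j) = (if j \<in> {1..n} then b j else 0)" for a b j
  proof -
    have "count (M (a, b)) (Vy j) = (\<Sum>i=1..n. if i = j then b i else 0)"
      unfolding M_def prod.case count_sum by (rule sum.cong) auto
    then show ?thesis by simp
  qed
  have cx': "count (M (a, b)) (Vx j) = a j" and cy': "count (M (a, b)) (Vy j) = b j"
    if "(a, b) \<in> cylindric_partitions_20 n" for a b j
    using that unfolding cx cy cylindric_partitions_20_def by auto
  have inj: "inj_on M (cylindric_partitions_20 n)"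
  proof (rule inj_onI)
    fix p p' assume *: "p \<in> cylindric_partitions_20 n" "p' \<in> cylindric_partitions_20 n" "M p = M p'"
    obtain a b a' b' where p: "p = (a, b)" and p': "p' = (a', b')" by force
    have "a j = a' j" "b j = b' j" for j
      using cx'[of a b j] cx'[of a' b' j] cy'[of a b j] cy'[of a' b' j] * unfolding p p' by simp_all
    then show "p = p'" unfolding p p' by (simp add: fun_eq_iff)
  qed
  have "M ` cylindric_partitions_20 n = cyl_msets n n"
  proof (intro equalityI subsetI)
    fix m assume "m \<in> M ` cylindric_partitions_20 n"
    then obtain a b where ab: "(a, b) \<in> cylindric_partitions_20 n" and "m = M (a, b)" by auto
    then show "m \<in> cyl_msets n n"
      unfolding cyl_msets_def mem_Collect_eq \<open>m = M (a, b)\<close> cx'[OF ab] cy'[OF ab]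
      by (simp add: cylindric_partitions_20_def)
  next
    fix m assume m: "m \<in> cyl_msets n n"
    define a b where "a = (\<lambda>j. count m (Vx j))" and "b = (\<lambda>j. count m (Vy j))"
    have ab: "(a, b) \<in> cylindric_partitions_20 n"
      using m unfolding cyl_msets_def cylindric_partitions_20_def a_def b_def by simp
    have "count m v = count (M (a, b)) v" for v
      by (cases v) (simp_all add: cx'[OF ab] cy'[OF ab], simp_all add: a_def b_def)
    then have "m = M (a, b)" by (rule multiset_eqI)
    with ab show "m \<in> M ` cylindric_partitions_20 n" by blast
  qed
  moreover have "(\<lambda>(a, b). \<Prod>i=1..n. xvar i ^ a i * yvar i ^ b i) = (\<lambda>p. mps_monom (M p))"
    by (simp only: mps_monom_power mps_monom_mult mps_monom_prod M_def case_prod_unfold)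
  ultimately show ?thesis
    unfolding CP_20_def using mps_sum_monom[OF inj] by simp
qed

section \<open>Shifting all entries by one\<close>

lemma cyl_msets_antimono:
  assumes "m \<in> cyl_msets p q" "1 \<le> i" "i \<le> j"
  shows "count m (Vx j) \<le> count m (Vx i)" "count m (Vy j) \<le> count m (Vy i)"
  using assms(3)
proof (induction j rule: dec_induct)
  case (step k)
  have "k \<ge> 1" using step assms(2) by simp
  then have le: "count m (Vx (Suc k)) \<le> count m (Vx k)" "count m (Vy (Suc k)) \<le> count m (Vy k)"
    using cyl_msetsD(3,4)[OF assms(1), of k] by simp_all
  { case 1 show ?case using le(1) step.IH(1) by (rule order_trans) }
  { case 2 show ?case using le(2) step.IH(2) by (rule order_trans) }
qed simp_all

text \<open>The bounds on \<open>p\<close> and \<open>q\<close> make the all-ones filling itself a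
  cylindric partition: \<open>q \<le> p\<close> serves \<open>a\<^sub>j \<ge> b\<^sub>j\<close> and
  \<open>p \<le> q + 2\<close> serves \<open>b\<^sub>j \<ge> a\<^sub>j\<^sub>+\<^sub>2\<close>. The
  inequalities then add up.\<close>

lemma XY_mset_add_in_cyl_msets:
  assumes "m \<in> cyl_msets p q" "q \<le> p" "p \<le> q + 2"
  shows "XY_mset p q + m \<in> cyl_msets p q"
proof (rule cyl_msetsI)
  fix j :: nat
  note D = cyl_msetsD[OF assms(1), of j]
  show "count (XY_mset p q + m) (Vx j) = 0" if "j \<notin> {1..p}" using D(1) that by simp
  show "count (XY_mset p q + m) (Vy j) = 0" if "j \<notin> {1..q}" using D(2) that by simp
  assume j: "j \<ge> 1"
  show "count (XY_mset p q + m) (Vx (j + 1)) \<le> count (XY_mset p q + m) (Vx j)"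
    using D(3) j by simp
  show "count (XY_mset p q + m) (Vy (j + 1)) \<le> count (XY_mset p q + m) (Vy j)"
    using D(4) j by simp
  show "count (XY_mset p q + m) (Vy j) \<le> count (XY_mset p q + m) (Vx j)"
    using D(5) j assms(2) by simp
  show "count (XY_mset p q + m) (Vx (j + 2)) \<le> count (XY_mset p q + m) (Vy j)"
    using D(6) j assms(3) by simp
qed

text \<open>Rows decrease, so a positive last entry makes the whole row positive and 1 can be
  subtracted everywhere.\<close>

lemma diff_XY_mset_in_cyl_msets:
  assumes m: "m \<in> cyl_msets p q" and pq: "q \<le> p" "p \<le> q + 2"
    and pos: "count m (Vx p) > 0" "q \<ge> 1 \<Longrightarrow> count m (Vy q) > 0"
  shows "XY_mset p q \<subseteq># m" "m - XY_mset p q \<in> cyl_msets p q"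
proof -
  have x: "count m (Vx j) > 0" if "j \<in> {1..p}" for j
    using cyl_msets_antimono(1)[OF m, of j p] that pos(1) by (simp del: count_greater_zero_iff)
  have y: "count m (Vy j) > 0" if "j \<in> {1..q}" for j
    using cyl_msets_antimono(2)[OF m, of j q] that pos(2) by (simp del: count_greater_zero_iff)
  show "XY_mset p q \<subseteq># m"
    unfolding subseteq_mset_def
  proof
    fix v show "count (XY_mset p q) v \<le> count m v"
      using x y by (cases v) (simp_all add: Suc_le_eq del: count_greater_zero_iff)
  qed
  show "m - XY_mset p q \<in> cyl_msets p q"
  proof (rule cyl_msetsI)
    fix j :: nat
    note D = cyl_msetsD[OF m]
    show "count (m - XY_mset p q) (Vx j) = 0" if "j \<notin> {1..p}" using D(1)[of j] that by simp
    show "count (m - XY_mset p q) (Vy j) = 0" if "j \<notin> {1..q}" using D(2)[of j] that by simp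
    assume j: "j \<ge> 1"
    show "count (m - XY_mset p q) (Vx (j + 1)) \<le> count (m - XY_mset p q) (Vx j)"
      \<comment> \<open>Here and below, either the smaller entry lies in its support, and then both
        sides drop by 1, or it is already 0.\<close>
      using D(3)[of j] D(1)[of "j + 1"] j by (cases "j + 1 \<le> p") simp_all
    show "count (m - XY_mset p q) (Vy (j + 1)) \<le> count (m - XY_mset p q) (Vy j)"
      using D(4)[of j] D(2)[of "j + 1"] j by (cases "j + 1 \<le> q") simp_all
    show "count (m - XY_mset p q) (Vy j) \<le> count (m - XY_mset p q) (Vx j)"
      using D(5)[of j] D(2)[of j] j pq by (cases "j \<le> q") simp_all
    show "count (m - XY_mset p q) (Vx (j + 2)) \<le> count (m - XY_mset p q) (Vy j)"
      using D(6)[of j] D(1)[of "j + 2"] j pq by (cases "j + 2 \<le> p") simp_all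
  qed
qed

text \<open>The shift misses the partitions with a vanishing last entry. The guard
  \<open>q \<ge> 1\<close> matters: for \<open>q = 0\<close> the multiplicity of \<open>Vy 0\<close>
  is always 0, and the condition would select everything.\<close>

lemma one_minus_XY_mult_cyl:
  assumes "1 \<le> p" "q \<le> p" "p \<le> q + 2"
  shows "(1 - mps_monom (XY_mset p q)) * mps_of_set (cyl_msets p q) =
    mps_of_set {m \<in> cyl_msets p q. count m (Vx p) = 0 \<or> q \<ge> 1 \<and> count m (Vy q) = 0}"
proof (rule one_minus_monom_mult_mps_of_set)
  show "XY_mset p q + t \<in> cyl_msets p q -
      {m \<in> cyl_msets p q. count m (Vx p) = 0 \<or> q \<ge> 1 \<and> count m (Vy q) = 0}"
    if "t \<in> cyl_msets p q" for t
    using XY_mset_add_in_cyl_msets[OF that assms(2,3)] assms(1) by auto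
  show "XY_mset p q \<subseteq># m \<and> m - XY_mset p q \<in> cyl_msets p q"
    if "m \<in> cyl_msets p q - {m \<in> cyl_msets p q. count m (Vx p) = 0 \<or> q \<ge> 1 \<and> count m (Vy q) = 0}"
    for m
    using diff_XY_mset_in_cyl_msets[of m p q] that assms by auto
qed auto

section \<open>Functional equations near the diagonal\<close>

text \<open>Used from left to right, this places the sets to be compared inside one larger set;
  fixing the smaller bound at each use keeps the rewriting from looping.\<close>

lemma cyl_msets_Suc_left_iff:
  "m \<in> cyl_msets p q \<longleftrightarrow> m \<in> cyl_msets (Suc p) q \<and> count m (Vx (Suc p)) = 0"
proof -
  have "(\<forall>j. j \<notin> {1..p} \<longrightarrow> count m (Vx j) = 0) \<longleftrightarrow>
      (\<forall>j. j \<notin> {1..Suc p} \<longrightarrow> count m (Vx j) = 0) \<and> count m (Vx (Suc p)) = 0"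
    by (auto simp: le_Suc_eq)
  then show ?thesis unfolding cyl_msets_def by blast
qed

lemma cyl_msets_Suc_right_iff:
  "m \<in> cyl_msets p q \<longleftrightarrow> m \<in> cyl_msets p (Suc q) \<and> count m (Vy (Suc q)) = 0"
proof -
  have "(\<forall>j. j \<notin> {1..q} \<longrightarrow> count m (Vy j) = 0) \<longleftrightarrow>
      (\<forall>j. j \<notin> {1..Suc q} \<longrightarrow> count m (Vy j) = 0) \<and> count m (Vy (Suc q)) = 0"
    by (auto simp: le_Suc_eq)
  then show ?thesis unfolding cyl_msets_def by blast
qed

lemma cyl_msets_Vx_0_imp_Vy_0:
  assumes "m \<in> cyl_msets p q" "j \<ge> 1" "count m (Vx j) = 0"
  shows "count m (Vy j) = 0"
  using cyl_msetsD(5)[OF assms(1,2)] assms(3) by simp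

lemma cyl_msets_Vy_0_imp_Vx_0:
  assumes "m \<in> cyl_msets p q" "j \<ge> 1" "count m (Vy j) = 0"
  shows "count m (Vx (Suc (Suc j))) = 0"
  using cyl_msetsD(6)[OF assms(1,2)] assms(3) by simp

text \<open>On the diagonal \<open>a\<^sub>j \<ge> b\<^sub>j\<close> lets a vanishing last
  \<open>a\<close> force a vanishing last \<open>b\<close>, so only the latter condition
  remains.\<close>

lemma one_minus_XY_mult_cyl_diagonal:
  "(1 - mps_monom (XY_mset (Suc n) (Suc n))) * mps_of_set (cyl_msets (Suc n) (Suc n)) =
    mps_of_set (cyl_msets (Suc n) n)"
proof -
  have "{m \<in> cyl_msets (Suc n) (Suc n).
      count m (Vx (Suc n)) = 0 \<or> Suc n \<ge> 1 \<and> count m (Vy (Suc n)) = 0} = cyl_msets (Suc n) n"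
    using cyl_msets_Vx_0_imp_Vy_0[of _ "Suc n" "Suc n" "Suc n"]
    by (auto simp: cyl_msets_Suc_right_iff[of _ _ n])
  then show ?thesis by (simp add: one_minus_XY_mult_cyl)
qed

text \<open>Neither vanishing condition implies the other here, hence inclusion-exclusion.\<close>

lemma one_minus_XY_mult_cyl_subdiagonal:
  "(1 - mps_monom (XY_mset (Suc (Suc n)) (Suc n))) * mps_of_set (cyl_msets (Suc (Suc n)) (Suc n)) =
    mps_of_set (cyl_msets (Suc n) (Suc n)) + mps_of_set (cyl_msets (Suc (Suc n)) n)
      - mps_of_set (cyl_msets (Suc n) n)"
proof -
  have "{m \<in> cyl_msets (Suc (Suc n)) (Suc n).
      count m (Vx (Suc (Suc n))) = 0 \<or> Suc n \<ge> 1 \<and> count m (Vy (Suc n)) = 0}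
      = cyl_msets (Suc n) (Suc n) \<union> cyl_msets (Suc (Suc n)) n"
    by (auto simp: cyl_msets_Suc_right_iff[of _ _ n] cyl_msets_Suc_left_iff[of _ "Suc n"])
  moreover have "cyl_msets (Suc n) (Suc n) \<inter> cyl_msets (Suc (Suc n)) n = cyl_msets (Suc n) n"
    by (auto simp: cyl_msets_Suc_right_iff[of _ _ n] cyl_msets_Suc_left_iff[of _ "Suc n"])
  ultimately show ?thesis by (simp add: one_minus_XY_mult_cyl mps_of_set_Un)
qed

text \<open>Now \<open>b\<^sub>j \<ge> a\<^sub>j\<^sub>+\<^sub>2\<close> gives the opposite
  implication, from the last \<open>b\<close> to the last \<open>a\<close>.\<close>

lemma one_minus_XY_mult_cyl_subsubdiagonal:
  "(1 - mps_monom (XY_mset (Suc (Suc n)) n)) * mps_of_set (cyl_msets (Suc (Suc n)) n) =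
    mps_of_set (cyl_msets (Suc n) n)"
proof -
  have "{m \<in> cyl_msets (Suc (Suc n)) n.
      count m (Vx (Suc (Suc n))) = 0 \<or> n \<ge> 1 \<and> count m (Vy n) = 0} = cyl_msets (Suc n) n"
    using cyl_msets_Vy_0_imp_Vx_0[of _ "Suc (Suc n)" n n]
    by (auto simp: cyl_msets_Suc_left_iff[of _ "Suc n"])
  then show ?thesis by (simp add: one_minus_XY_mult_cyl)
qed

section \<open>Initial values, recurrence and product formula\<close>

lemma cyl_msets_0_0: "cyl_msets 0 0 = {{#}}"
proof (intro equalityI subsetI)
  fix m assume "m \<in> cyl_msets 0 0"
  then have "count m v = 0" for v unfolding cyl_msets_def by (cases v) auto
  then show "m \<in> {{#}}" by (auto intro: multiset_eqI)
qed (auto simp: cyl_msets_def)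

text \<open>Replaces the case \<open>p = q + 2\<close> when \<open>p = 1\<close>, where
  \<open>q\<close> would be negative.\<close>

lemma one_minus_XY_mult_cyl_1_0:
  "(1 - mps_monom (XY_mset (Suc 0) 0)) * mps_of_set (cyl_msets (Suc 0) 0) =
    mps_of_set (cyl_msets 0 0)"
proof -
  have "{m \<in> cyl_msets (Suc 0) 0. count m (Vx (Suc 0)) = 0 \<or> (0::nat) \<ge> 1 \<and> count m (Vy 0) = 0}
      = cyl_msets 0 0"
    by (auto simp: cyl_msets_Suc_left_iff[of _ 0])
  then show ?thesis by (simp add: one_minus_XY_mult_cyl)
qed

text \<open>For \<open>n = 0\<close> truncated subtraction realises the convention \<open>Y\<^sub>i = 1\<close> for \<open>i \<le> 0\<close>.\<close>

lemma cyl_msets_recurrence: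
  fixes n :: nat
  defines "F \<equiv> \<lambda>p q. 1 - mps_monom (XY_mset p q) :: (var, int) mps"
  shows "(F (Suc n) (n - 1) * F (Suc n) n * F (Suc n) (Suc n)) * mps_of_set (cyl_msets (Suc n) (Suc n))
    = (1 - mps_monom (XY_mset n n) * mps_monom (XY_mset (Suc n) (n - 1))) * mps_of_set (cyl_msets n n)"
proof -
  define H :: "nat \<Rightarrow> nat \<Rightarrow> (var, int) mps" where "H = (\<lambda>p q. mps_of_set (cyl_msets p q))"
  have diag: "F (Suc k) (Suc k) * H (Suc k) (Suc k) = H (Suc k) k" for k
    unfolding F_def H_def by (rule one_minus_XY_mult_cyl_diagonal)
  show ?thesis
  proof (cases n)
    case 0
    have *: "F (Suc 0) 0 * H (Suc 0) 0 = H 0 0"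
      unfolding F_def H_def by (rule one_minus_XY_mult_cyl_1_0)
    \<comment> \<open>Two of the three factors coincide: one is absorbed by \<open>*\<close>, the
      other survives as the numerator.\<close>
    have "F (Suc 0) 0 * F (Suc 0) 0 * F (Suc 0) (Suc 0) * H (Suc 0) (Suc 0)
        = F (Suc 0) 0 * (F (Suc 0) 0 * (F (Suc 0) (Suc 0) * H (Suc 0) (Suc 0)))"
      by (simp only: mult.assoc)
    also have "\<dots> = F (Suc 0) 0 * H 0 0" unfolding diag * ..
    finally show ?thesis
      unfolding 0 H_def F_def by (simp add: XY_mset_def mps_monom_mult)
  next
    case (Suc k)
    \<comment> \<open>With \<open>n = k + 1\<close>, \<open>P\<close> is the monomial of the first
      factor \<open>F (Suc n) (n - 1)\<close>, and \<open>P * Q\<close> is the monomial in the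
      numerator.\<close>
    define P Q where "P = (mps_monom (XY_mset (Suc (Suc k)) k) :: (var, int) mps)"
      and "Q = (mps_monom (XY_mset (Suc k) (Suc k)) :: (var, int) mps)"
    have P: "(1 - P) * H (Suc (Suc k)) k = H (Suc k) k"
      unfolding P_def H_def by (rule one_minus_XY_mult_cyl_subsubdiagonal)
    have Q: "(1 - Q) * H (Suc k) (Suc k) = H (Suc k) k"
      unfolding Q_def H_def by (rule one_minus_XY_mult_cyl_diagonal)
    have sub: "F (Suc (Suc k)) (Suc k) * H (Suc (Suc k)) (Suc k)
        = H (Suc k) (Suc k) + H (Suc (Suc k)) k - H (Suc k) k"
      unfolding F_def H_def by (rule one_minus_XY_mult_cyl_subdiagonal)
    have "(1 - P) * F (Suc (Suc k)) (Suc k) * F (Suc (Suc k)) (Suc (Suc k)) * H (Suc (Suc k)) (Suc (Suc k))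
        = (1 - P) * (F (Suc (Suc k)) (Suc k) * (F (Suc (Suc k)) (Suc (Suc k)) * H (Suc (Suc k)) (Suc (Suc k))))"
      by (simp only: mult.assoc)
    also have "\<dots> = (1 - P) * (H (Suc k) (Suc k) - H (Suc k) k) + (1 - P) * H (Suc (Suc k)) k"
      unfolding diag sub by (simp add: algebra_simps)
    \<comment> \<open>\<open>P\<close> and \<open>Q\<close> give two expressions for
      \<open>H (Suc k) k\<close>; through them everything becomes a multiple of
      \<open>H (Suc k) (Suc k)\<close>, with coefficient
      \<open>(1 - P) * Q + (1 - Q) = 1 - Q * P\<close>.\<close>
    also have "\<dots> = (1 - P) * (H (Suc k) (Suc k) - (1 - Q) * H (Suc k) (Suc k)) + (1 - Q) * H (Suc k) (Suc k)"
      unfolding P Q ..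
    also have "\<dots> = (1 - Q * P) * H (Suc k) (Suc k)"
      by (simp add: algebra_simps)
    finally show ?thesis
      unfolding Suc H_def F_def P_def Q_def by simp
  qed
qed

theorem theorem3p4:
  fixes n :: nat
  assumes "n \<ge> 1"
  shows "CP_20 n =
    (\<Prod>i=1..int n. (1 - Xprod (i - 1) * Xprod i * Yprod (i - 2) * Yprod (i - 1)) /
      ((1 - Xprod i * Yprod (i - 2)) * (1 - Xprod i * Yprod (i - 1)) * (1 - Xprod i * Yprod i)))"
proof -
  let ?f = "\<lambda>i. (1 - Xprod (i - 1) * Xprod i * Yprod (i - 2) * Yprod (i - 1)) /
      ((1 - Xprod i * Yprod (i - 2)) * (1 - Xprod i * Yprod (i - 1)) * (1 - Xprod i * Yprod i))"
  have "CP_20 k = (\<Prod>i=1..int k. ?f i)" for k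
  proof (induction k)
    case 0
    show ?case by (simp add: CP_20_eq_mps_of_set cyl_msets_0_0 mps_of_set_empty_mset)
  next
    case (Suc k)
    define i where "i = int (Suc k)"
    have nat: "nat i = Suc k" "nat (i - 1) = k" "nat (i - 2) = k - 1"
      by (simp_all add: i_def)
    \<comment> \<open>The factors are paired so that both pairs are monomials of the
      recurrence.\<close>
    have num: "Xprod (i - 1) * Xprod i * Yprod (i - 2) * Yprod (i - 1)
        = (Xprod (i - 1) * Yprod (i - 1)) * (Xprod i * Yprod (i - 2))"
      by (simp only: ac_simps)
    have "CP_20 (Suc k) = ?f i * CP_20 k"
      unfolding CP_20_eq_mps_of_set num Xprod_mult_Yprod nat
      \<comment> \<open>Each denominator factor is a unit because its monomial contains
        \<open>x\<^sub>1\<close> and so differs from 1.\<close>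
      by (intro mps_divide_mult_cancel cyl_msets_recurrence mps_mult_inverse_mult
          mps_inverse_one_minus_monom XY_mset_neq_empty) simp_all
    moreover have "{1..int (Suc k)} = insert i {1..int k}" "i \<notin> {1..int k}"
      by (auto simp: i_def)
    ultimately show ?case by (simp add: Suc.IH)
  qed
  then show ?thesis .
qed

end
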